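(* Let $F:2^{[n]}\to\mathbb{R}$ be submodular with $F(\emptyset)=0$, and suppose $g:\mathbb{R}^n\to\mathbb{R}$ is $\alpha$-smooth and $\beta$-strongly convex. Let $M$ be the diameter of $B(F)$ and $\delta$ the pyramidal width of $B(F)$. Then the lower bounds $d^{(i)}$ in the algorithm L-FCFW, applied to $h(w)=-g^*(-w)$ and $F$, converge linearly at the rate $1-\rho$, i.e., $$p^\star-d^{(i+1)}\le(1-\rho)\,(p^\star-d^{(i)}),\qquad\text{where } \rho=\frac{\beta}{4\alpha}\Big(\frac{\delta}{M}\Big)^2$$ and $p^\star=\min_{x\in\mathbb{R}^n} f(x)+g(x)$.
   Context: $[n]=\{1,\dots,n\}$. $F$ is submodular if $F(A)+F(B)\ge F(A\cup B)+F(A\cap B)$ for all $A,B\subseteq[n]$. With $w(A)=\sum_{k\in A}w_k$, the base polytope is $B(F)=\{w\in\mathbb{R}^n: w(A)\le F(A)\ \forall A\subseteq[n],\ w([n])=F([n])\}$, with vertex set $\mathrm{vert}(B(F))$; the Lovász extension is $f(x)=\max_{w\in B(F)}w^\top x$. A function $g$ is $\beta$-strongly convex ($\beta>0$) if $g-\frac{\beta}{2}\|\cdot\|^2$ is convex, and $\alpha$-smooth ($\alpha>0$) if $g-\frac{\alpha}{2}\|\cdot\|^2$ is concave. Convex functions are assumed closed and proper. $g^*(w)=\max_{x\in\mathbb{R}^n}w^\top x-g(x)$ is the Fenchel conjugate. Algorithm L-FCFW (Limited Memory Fully Corrective Frank-Wolfe) for maximizing a smooth concave $h$ over $B(F)$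 with tolerance $\epsilon\ge0$: choose a nonempty set $\mathcal{V}^{(0)}\subseteq\mathrm{vert}(B(F))$. For $i=1,2,\dots$: (1) solve $w^{(i)}=\operatorname{argmax}\{h(w): w\in\mathrm{conv}(\mathcal{V}^{(i-1)})\}$ and define $\lambda_v\ge0$ ($v\in\mathcal{V}^{(i-1)}$) so that $w^{(i)}=\sum_v\lambda_v v$ and $\sum_v\lambda_v=1$; (2) compute $x^{(i)}=\nabla h(w^{(i)})$ and solve $v^{(i)}=\operatorname{argmax}\{w^\top x^{(i)}: w\in B(F)\}$; (3) break if the duality gap satisfies $p^{(i)}-d^{(i)}\le\epsilon$, where $p^{(i)}=(v^{(i)})^\top x^{(i)}$ and $d^{(i)}=(w^{(i)})^\top x^{(i)}$; (4) choose any superset of active vertices $\mathcal{B}^{(i)}\supseteq\{w\in\mathcal{V}^{(i-1)}:\lambda_w>0\}$ and set $\mathcal{V}^{(i)}=\mathcal{B}^{(i)}\cup\{v^{(i)}\}$. Return $w^{(i)}$. Diameter: $\mathrm{Diam}(\mathcal{P})=\max_{v,w\in\mathcal{P}}\|v-w\|_2$. Directional width of a set $\mathcal{P}$ with respect to a direction $x$: $\mathrm{dirW}(\mathcal{P},x)=\max_{v,w\in\mathcal{P}}(v-w)^\top x/\|x\|_2$. For a finite set $\mathcal{V}\subset\mathbb{R}^n$, a direction $x$ and a base point $w\in\mathrm{conv}(\mathcal{V})$, the pyramid directional width is $\mathrm{PdirW}(\mathcal{V},x,w)=\min_{A\in\mathcal{A}(w)}\mathrm{dirW}(A\cup\{v(\mathcal{V},x)\},x)$,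 where $\mathcal{A}(w)$ is the collection of $A\subseteq\mathcal{V}$ such that $w$ is a convex combination of the elements of $A$ with all multipliers nonzero, and $v(\mathcal{V},x)$ is a vector in $\operatorname{argmax}_{v\in\mathcal{V}}v^\top x$. The pyramidal width of a polytope $\mathcal{P}$ is $$\mathrm{PWidth}(\mathcal{P})=\min_{\mathcal{K}\in\mathrm{face}(\mathcal{P})}\ \min_{x\in\mathrm{cone}(\mathcal{K}-w)\setminus\{0\},\ w\in\mathcal{K}}\mathrm{PdirW}(\mathcal{K}\cap\mathrm{vert}(\mathcal{P}),x,w),$$ where $\mathrm{face}(\mathcal{P})$ is the set of faces of $\mathcal{P}$ and $\mathrm{cone}(\mathcal{K}-w)$ is the set of vectors pointing from $w$ inwards into $\mathcal{K}$.
   Formalization: The lower bound d^(i) is taken as the dual value h(w^(i)) = w^(i)·x^(i) + g(x^(i)), since with d^(i) = w^(i)·x^(i) the claim fails when a constant is added to g; v^(i) and the elements of B^(i) are taken to be vertices of B(F). *)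

theory Defs
  imports "HOL-Analysis.Analysis"
begin

text \<open>
  The ground set $[n]$ is a finite type \<open>'n\<close>, so that set functions have type
  \<open>'n set \<Rightarrow> real\<close> and vectors have type \<open>real ^ 'n\<close>.
\<close>

definition submodular :: "('n::finite set \<Rightarrow> real) \<Rightarrow> bool" where
  "submodular F \<longleftrightarrow> (\<forall>A B. F A + F B \<ge> F (A \<union> B) + F (A \<inter> B))"

definition base_polytope :: "('n::finite set \<Rightarrow> real) \<Rightarrow> (real ^ 'n) set" where
  "base_polytope F =
     {w. (\<forall>A. (\<Sum>k\<in>A. w $ k) \<le> F A) \<and> (\<Sum>k\<in>UNIV. w $ k) = F UNIV}"

definition vert :: "'a::real_vector set \<Rightarrow> 'a set" where
  "vert P = {v. v extreme_point_of P}"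

definition lovasz_extension :: "('n::finite set \<Rightarrow> real) \<Rightarrow> real ^ 'n \<Rightarrow> real" where
  "lovasz_extension F x = (SUP w\<in>base_polytope F. w \<bullet> x)"

definition strongly_convex :: "real \<Rightarrow> ('a::real_inner \<Rightarrow> real) \<Rightarrow> bool" where
  "strongly_convex \<beta> g \<longleftrightarrow> \<beta> > 0 \<and> convex_on UNIV (\<lambda>x. g x - \<beta> / 2 * (norm x)\<^sup>2)"

definition smooth :: "real \<Rightarrow> ('a::real_inner \<Rightarrow> real) \<Rightarrow> bool" where
  "smooth \<alpha> g \<longleftrightarrow> \<alpha> > 0 \<and> concave_on UNIV (\<lambda>x. g x - \<alpha> / 2 * (norm x)\<^sup>2)"

text \<open>Real-valued; the supremum is finite (and attained) when \<open>g\<close> is strongly convex.\<close>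

definition fenchel_conjugate :: "('a::real_inner \<Rightarrow> real) \<Rightarrow> 'a \<Rightarrow> real" where
  "fenchel_conjugate g w = (SUP x. w \<bullet> x - g x)"

definition dirW :: "'a::real_inner set \<Rightarrow> 'a \<Rightarrow> real" where
  "dirW P x = Sup {((v - w) \<bullet> x) / norm x | v w. v \<in> P \<and> w \<in> P}"

definition active_sets :: "'a::real_vector set \<Rightarrow> 'a \<Rightarrow> 'a set set" where
  "active_sets V w = {A. A \<subseteq> V \<and>
     (\<exists>c. (\<forall>v\<in>A. c v \<ge> 0 \<and> c v \<noteq> 0) \<and> (\<Sum>v\<in>A. c v) = 1 \<and> w = (\<Sum>v\<in>A. c v *\<^sub>R v))}"

definition PdirW :: "'a::real_inner set \<Rightarrow> 'a \<Rightarrow> 'a \<Rightarrow> real" where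
  "PdirW V x w = (INF A\<in>active_sets V w. dirW (A \<union> {arg_max_on (\<lambda>v. v \<bullet> x) V}) x)"

text \<open>
  The iterated minimum is written as one infimum over all triples (face, base point, direction):
  a face that is a single point admits no direction \<open>x \<noteq> 0\<close>, and an inner infimum over the
  empty set would be an arbitrary real number.
\<close>

definition PWidth :: "'a::real_inner set \<Rightarrow> real" where
  "PWidth P = Inf {PdirW (K \<inter> vert P) x w | K x w.
     K face_of P \<and> w \<in> K \<and> x \<in> cone hull ((\<lambda>y. y - w) ` K) - {0}}"

text \<open>
  \<open>lfcfw_run h F \<epsilon> N V w lam x v B\<close>: an execution of L-FCFW for maximizing \<open>h\<close> over the base
  polytope of \<open>F\<close> with tolerance \<open>\<epsilon>\<close> that reaches iteration \<open>N\<close>.  Iterations are numbered from 1.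
  Steps (1) and (2) are carried out in iterations \<open>1, \<dots>, N\<close>; since iteration \<open>N\<close> is reached, the
  test (3) does not stop the execution in iterations \<open>1, \<dots>, N - 1\<close>, and step (4) is carried out
  there.  Iteration \<open>N\<close> itself may or may not be the last one.

  All sets \<open>V i\<close> consist of vertices of the base polytope: the linear maximization in step (2)
  returns a vertex, and the superset \<open>B i\<close> in step (4) is a set of vertices.
\<close>

definition lfcfw_run ::
  "(real ^ 'n \<Rightarrow> real) \<Rightarrow> ('n::finite set \<Rightarrow> real) \<Rightarrow> real \<Rightarrow> nat \<Rightarrow>
   (nat \<Rightarrow> (real ^ 'n) set) \<Rightarrow> (nat \<Rightarrow> real ^ 'n) \<Rightarrow> (nat \<Rightarrow> real ^ 'n \<Rightarrow> real) \<Rightarrow>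
   (nat \<Rightarrow> real ^ 'n) \<Rightarrow> (nat \<Rightarrow> real ^ 'n) \<Rightarrow> (nat \<Rightarrow> (real ^ 'n) set) \<Rightarrow> bool" where
  "lfcfw_run h F \<epsilon> N V w lam x v B \<longleftrightarrow>
     V 0 \<noteq> {} \<and> V 0 \<subseteq> vert (base_polytope F) \<and>
     (\<forall>i\<in>{1..N}.
        is_arg_max h (\<lambda>u. u \<in> convex hull (V (i - 1))) (w i) \<and>
        (\<forall>u\<in>V (i - 1). lam i u \<ge> 0) \<and>
        (\<Sum>u\<in>V (i - 1). lam i u) = 1 \<and>
        w i = (\<Sum>u\<in>V (i - 1). lam i u *\<^sub>R u) \<and>
        GDERIV h (w i) :> x i \<and>
        is_arg_max (\<lambda>u. u \<bullet> x i) (\<lambda>u. u \<in> base_polytope F) (v i) \<and>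
        v i \<in> vert (base_polytope F)) \<and>
     (\<forall>i\<in>{1..<N}.
        \<not> v i \<bullet> x i - w i \<bullet> x i \<le> \<epsilon> \<and>
        {u \<in> V (i - 1). lam i u > 0} \<subseteq> B i \<and>
        B i \<subseteq> vert (base_polytope F) \<and>
        V i = B i \<union> {v i})"

text \<open>
  The lower bound on $p^\star = \min (f + g)$ certified in iteration \<open>i\<close>: the value of the dual
  objective \<open>h\<close> at \<open>w i\<close>.  For \<open>h = (\<lambda>u. - fenchel_conjugate g (- u))\<close> it equals
  \<open>w i \<bullet> x i + g (x i)\<close>, and the matching upper bound $f(x^{(i)}) + g(x^{(i)})$ is
  \<open>v i \<bullet> x i + g (x i)\<close>.  The stopping test only involves the difference of the two bounds, where
  the common term \<open>g (x i)\<close> cancels.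
\<close>

definition lfcfw_lower_bound :: "('a \<Rightarrow> real) \<Rightarrow> (nat \<Rightarrow> 'a) \<Rightarrow> nat \<Rightarrow> real" where
  "lfcfw_lower_bound h w i = h (w i)"

end

theory Submission
  imports Defs
begin

text \<open>
  Strong convexity and smoothness of \<open>g\<close> turn into quadratic upper and lower bounds for the dual
  objective \<open>h\<close> with constants \<open>1 / \<alpha>\<close> and \<open>1 / \<beta>\<close>. In iteration \<open>i\<close> all active vertices lie on the
  level set of the gradient \<open>r\<close> through \<open>w i\<close>, because \<open>w i\<close> is optimal on the hull of the current
  vertices; so the Frank-Wolfe gap \<open>r \<bullet> (v i - w i)\<close> is also the pairwise gap, and the pyramidal
  width yields \<open>\<delta> * (r \<bullet> e) \<le> gap * norm e\<close> for \<open>e\<close> pointing from \<open>w i\<close> to a dual optimum. With strong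
  concavity this gives \<open>\<delta>\<^sup>2 * (p_star - h (w i)) \<le> \<alpha> / 2 * gap\<^sup>2\<close>, while one Frank-Wolfe step, which
  stays in the hull of \<open>V i\<close>, already improves \<open>h\<close> by \<open>\<beta> / (2 * M\<^sup>2) * gap\<^sup>2\<close>, or by \<open>gap / 2\<close> when
  the optimal step size exceeds 1.
\<close>

section \<open>Quadratic bounds for the conjugate\<close>

text \<open>The limit of s to 0 in the form used below: first-order arguments divide by a step
  length s and are left with an error proportional to s.\<close>

lemma le_of_le_add_small:
  fixes a b c :: real
  assumes "\<And>s. 0 < s \<Longrightarrow> s < 1 \<Longrightarrow> a \<le> b + s * c"
  shows "a \<le> b"
proof (rule tendsto_lowerbound)
  show "((\<lambda>s. b + s * c) \<longlongrightarrow> b) (at_right 0)"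
    by (auto intro!: tendsto_eq_intros)
  show "\<forall>\<^sub>F s in at_right 0. a \<le> b + s * c"
    using assms by (auto simp: eventually_at_right_field intro!: exI[of _ 1])
qed simp

text \<open>Being an identity, it serves both directions: convexity and concavity of
  \<open>g\<close> minus a multiple of the squared norm become interpolation inequalities with the
  same kind of error term.\<close>

lemma norm_interpolation:
  fixes x d :: "'a::real_inner"
  shows "(norm (x + t *\<^sub>R d))\<^sup>2
    = (1 - t) * (norm x)\<^sup>2 + t * (norm (x + d))\<^sup>2 - t * (1 - t) * (norm d)\<^sup>2"
  unfolding power2_norm_eq_inner by (simp add: inner_simps inner_commute algebra_simps)

lemma strongly_convex_interpolation:
  assumes "strongly_convex \<beta> g" "0 \<le> t" "t \<le> 1"
  shows "g (x + t *\<^sub>R d) \<le> (1 - t) * g x + t * g (x + d) - \<beta> / 2 * (t * (1 - t) * (norm d)\<^sup>2)"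
proof -
  define c where "c = \<beta> / 2"
  have "x + t *\<^sub>R d = (1 - t) *\<^sub>R x + t *\<^sub>R (x + d)"
    by (simp add: algebra_simps)
  then have "g (x + t *\<^sub>R d) - c * (norm (x + t *\<^sub>R d))\<^sup>2
      \<le> (1 - t) * (g x - c * (norm x)\<^sup>2) + t * (g (x + d) - c * (norm (x + d))\<^sup>2)"
    using convex_onD[of UNIV "\<lambda>x. g x - \<beta> / 2 * (norm x)\<^sup>2" t x "x + d"] assms
    by (simp add: strongly_convex_def c_def)
  then have "g (x + t *\<^sub>R d) \<le> (1 - t) * g x + t * g (x + d) - c * (t * (1 - t) * (norm d)\<^sup>2)"
    unfolding norm_interpolation by (simp add: algebra_simps)
  then show ?thesis
    by (simp add: c_def)
qed

lemma smooth_interpolation: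
  assumes "smooth \<alpha> g" "0 \<le> t" "t \<le> 1"
  shows "g (x + t *\<^sub>R d) \<ge> (1 - t) * g x + t * g (x + d) - \<alpha> / 2 * (t * (1 - t) * (norm d)\<^sup>2)"
proof -
  define c where "c = \<alpha> / 2"
  have "x + t *\<^sub>R d = (1 - t) *\<^sub>R x + t *\<^sub>R (x + d)"
    by (simp add: algebra_simps)
  then have "g (x + t *\<^sub>R d) - c * (norm (x + t *\<^sub>R d))\<^sup>2
      \<ge> (1 - t) * (g x - c * (norm x)\<^sup>2) + t * (g (x + d) - c * (norm (x + d))\<^sup>2)"
    using convex_onD[of UNIV "\<lambda>x. - (g x - \<alpha> / 2 * (norm x)\<^sup>2)" t x "x + d"] assms
    by (simp add: smooth_def concave_on_def algebra_simps c_def)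
  then have "g (x + t *\<^sub>R d) \<ge> (1 - t) * g x + t * g (x + d) - c * (t * (1 - t) * (norm d)\<^sup>2)"
    unfolding norm_interpolation by (simp add: algebra_simps)
  then show ?thesis
    by (simp add: c_def)
qed

lemma strongly_convex_imp_continuous_on:
  fixes g :: "'a::euclidean_space \<Rightarrow> real"
  assumes "strongly_convex \<beta> g"
  shows "continuous_on UNIV g"
proof -
  have "continuous_on UNIV (\<lambda>x. g x - \<beta> / 2 * (norm x)\<^sup>2)"
    using assms by (intro convex_on_continuous) (auto simp: strongly_convex_def)
  then have "continuous_on UNIV (\<lambda>x. (g x - \<beta> / 2 * (norm x)\<^sup>2) + \<beta> / 2 * (norm x)\<^sup>2)"
    by (rule continuous_on_add) (intro continuous_intros)
  then show ?thesis
    by (simp only: diff_add_cancel)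
qed

lemma strongly_convex_diff_inner:
  assumes "strongly_convex \<beta> g"
  shows "strongly_convex \<beta> (\<lambda>x. g x - u \<bullet> x)"
proof -
  have "convex_on UNIV (\<lambda>x. (g x - \<beta> / 2 * (norm x)\<^sup>2) + (- u) \<bullet> x)"
    using assms
    by (intro convex_on_add) (auto simp: strongly_convex_def convex_on_def inner_simps)
  then show ?thesis
    using assms by (simp add: strongly_convex_def algebra_simps)
qed

text \<open>Coercivity along rays from 0: far out, quadratic growth outweighs any descent between 0
  and the unit sphere. So \<open>g\<close> is at least \<open>g 0\<close> outside a large ball, and
  the minimum over the ball is global.\<close>

lemma strongly_convex_attains_min:
  fixes g :: "'a::euclidean_space \<Rightarrow> real"
  assumes g: "strongly_convex \<beta> g"
  obtains X where "\<And>x. g X \<le> g x"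
proof -
  have \<beta>: "\<beta> > 0" and cont: "continuous_on S g" for S
    using g strongly_convex_imp_continuous_on[OF g] continuous_on_subset
    by (auto simp: strongly_convex_def)
  obtain e where e: "norm e = 1" "\<And>y. norm y = 1 \<Longrightarrow> g e \<le> g y"
    using continuous_attains_inf[OF compact_sphere _ cont, of "0::'a" 1] by auto
  \<comment> \<open>Chosen so that \<open>\<beta> / 2 * (R - 1)\<close> equals the absolute value of
    \<open>g e - g 0\<close>.\<close>
  define R where "R = 1 + 2 * \<bar>g e - g 0\<bar> / \<beta>"
  have "R \<ge> 1"
    using \<beta> by (simp add: R_def)
  then obtain X where "\<forall>y\<in>cball 0 R. g X \<le> g y"
    using continuous_attains_inf[OF compact_cball _ cont, of "0::'a" R] by auto
  then have X: "g X \<le> g y" if "norm y \<le> R" for y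
    using that by simp
  have "g X \<le> g x" if "norm x > R" for x
  proof -
    define r where "r = norm x"
    have r: "r > 1" "r > R"
      using that \<open>R \<ge> 1\<close> by (auto simp: r_def)
    have "g e \<le> g ((1 / r) *\<^sub>R x)"
      using r by (intro e) (auto simp: r_def)
    also have "\<dots> \<le> (1 - 1 / r) * g 0 + 1 / r * g x - \<beta> / 2 * (1 / r * (1 - 1 / r) * r\<^sup>2)"
    proof -
      have "0 \<le> 1 / r" "1 / r \<le> 1"
        using r by simp_all
      then show ?thesis
        using strongly_convex_interpolation[OF g, of "1 / r" 0 x] unfolding r_def[symmetric] by simp
    qed
    finally have "r * g e \<le> r * ((1 - 1 / r) * g 0 + 1 / r * g x - \<beta> / 2 * (1 / r * (1 - 1 / r) * r\<^sup>2))"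
      using r by simp
    also have "\<dots> = (r - 1) * g 0 + g x - \<beta> / 2 * (r * (r - 1))"
      using r by (simp add: field_simps power2_eq_square)
    finally have "g x \<ge> g 0 + r * ((g e - g 0) + \<beta> / 2 * (r - 1))"
      by (simp add: algebra_simps)
    moreover have "(g e - g 0) + \<beta> / 2 * (r - 1) \<ge> 0"
    proof -
      have "\<beta> / 2 * (R - 1) \<le> \<beta> / 2 * (r - 1)"
        using r \<beta> by simp
      moreover have "\<beta> / 2 * (R - 1) = \<bar>g e - g 0\<bar>"
        using \<beta> by (simp add: R_def)
      ultimately show ?thesis
        by linarith
    qed
    ultimately have "g x \<ge> g 0"
      using r by (smt (verit) mult_nonneg_nonneg)
    then show ?thesis
      using X[of 0] \<open>R \<ge> 1\<close> by simp
  qed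
  then show thesis
    using X that by (meson not_le)
qed

text \<open>Moving a fraction s of the way from \<open>X\<close> to \<open>x\<close> cannot go below
  \<open>g X\<close>; the interpolation inequality divided by s gives the claim up to an error that
  vanishes with s.\<close>

lemma strongly_convex_min_growth:
  assumes g: "strongly_convex \<beta> g" and X: "\<And>x. g X \<le> g x"
  shows "g X + \<beta> / 2 * (norm (x - X))\<^sup>2 \<le> g x"
proof -
  define D where "D = \<beta> / 2 * (norm (x - X))\<^sup>2"
  have "g X + D \<le> g x + s * D" if s: "0 < s" "s < 1" for s
  proof -
    have "g X \<le> (1 - s) * g X + s * g x - s * ((1 - s) * D)"
      using X[of "X + s *\<^sub>R (x - X)"] strongly_convex_interpolation[OF g, of s X "x - X"] s
      by (simp add: D_def mult_ac)
    then have "s * (g X + D) \<le> s * (g x + s * D)"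
      by (simp add: algebra_simps)
    then show ?thesis
      using s by simp
  qed
  then have "g X + D \<le> g x"
    by (rule le_of_le_add_small)
  then show ?thesis
    by (simp add: D_def)
qed

text \<open>A subgradient replaces the derivative. \<open>X\<close> lies between
  \<open>X + d\<close> and a point slightly behind \<open>X\<close>; smoothness bounds
  \<open>g (X + d)\<close> through the values at the other two points, and the subgradient bounds
  the rear value from below.\<close>

lemma smooth_subgradient_growth:
  assumes g: "smooth \<alpha> g" and X: "\<And>x. g x \<ge> g X + u \<bullet> (x - X)"
  shows "g (X + d) \<le> g X + u \<bullet> d + \<alpha> / 2 * (norm d)\<^sup>2"
proof (rule le_of_le_add_small)
  fix s :: real assume s: "0 < s" "s < 1"
  define D where "D = \<alpha> / 2 * (norm d)\<^sup>2"
  have eq: "(X - s *\<^sub>R d) + (s / (1 + s)) *\<^sub>R ((1 + s) *\<^sub>R d) = X"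
    "(X - s *\<^sub>R d) + (1 + s) *\<^sub>R d = X + d"
  proof -
    have "s / (1 + s) * (1 + s) = s"
      using s by simp
    then show "(X - s *\<^sub>R d) + (s / (1 + s)) *\<^sub>R ((1 + s) *\<^sub>R d) = X"
      by (simp only: scaleR_scaleR) simp
  qed (simp add: algebra_simps)
  \<comment> \<open>The weight \<open>s / (1 + s)\<close> places \<open>X\<close> between the two
    points; the factor \<open>1 + s\<close> clears its denominator.\<close>
  have "(1 + s) * g X \<ge> (1 + s) * ((1 - s / (1 + s)) * g (X - s *\<^sub>R d) + s / (1 + s) * g (X + d)
      - \<alpha> / 2 * (s / (1 + s) * (1 - s / (1 + s)) * (norm ((1 + s) *\<^sub>R d))\<^sup>2))"
    using smooth_interpolation[OF g, of "s / (1 + s)" "X - s *\<^sub>R d" "(1 + s) *\<^sub>R d", unfolded eq] s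
    by (intro mult_left_mono) auto
  also have "(1 + s) * ((1 - s / (1 + s)) * g (X - s *\<^sub>R d) + s / (1 + s) * g (X + d)
      - \<alpha> / 2 * (s / (1 + s) * (1 - s / (1 + s)) * (norm ((1 + s) *\<^sub>R d))\<^sup>2))
      = g (X - s *\<^sub>R d) + s * g (X + d) - s * (1 + s) * D"
  proof -
    define k where "k = 1 + s"
    have k: "1 - s / k = 1 / k" "k \<noteq> 0"
      using s by (auto simp: field_simps k_def)
    have norm: "(norm (k *\<^sub>R d))\<^sup>2 = k\<^sup>2 * (norm d)\<^sup>2"
      by (simp add: power_mult_distrib)
    show ?thesis
      unfolding k_def[symmetric] k(1) norm using k(2)
      by (simp add: D_def power2_eq_square field_simps)
  qed
  finally have "s * g (X + d) \<le> (1 + s) * g X - g (X - s *\<^sub>R d) + s * (1 + s) * D"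
    by simp
  also have "\<dots> \<le> s * (g X + u \<bullet> d + D + s * D)"
    using X[of "X - s *\<^sub>R d"] by (simp add: algebra_simps)
  finally show "g (X + d) \<le> g X + u \<bullet> d + \<alpha> / 2 * (norm d)\<^sup>2 + s * (\<alpha> / 2 * (norm d)\<^sup>2)"
    using s by (simp add: D_def)
qed

text \<open>\<open>X\<close> is the maximizer defining the conjugate at \<open>u\<close>. Smoothness
  limits the growth of \<open>g\<close> around \<open>X\<close>, so a test point near
  \<open>X\<close> bounds the conjugate at \<open>u'\<close> from below; strong convexity penalizes
  the maximizer for \<open>u'\<close> by its distance from \<open>X\<close>, which gives the upper
  bound.\<close>

lemma fenchel_conjugate_bounds:
  fixes g :: "'a::euclidean_space \<Rightarrow> real"
  assumes sm: "smooth \<alpha> g" and sc: "strongly_convex \<beta> g"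
  obtains X where "fenchel_conjugate g u = u \<bullet> X - g X"
    "\<forall>u'. fenchel_conjugate g u + (u' - u) \<bullet> X + (norm (u' - u))\<^sup>2 / (2 * \<alpha>) \<le> fenchel_conjugate g u'"
    "\<forall>u'. fenchel_conjugate g u' \<le> fenchel_conjugate g u + (u' - u) \<bullet> X + (norm (u' - u))\<^sup>2 / (2 * \<beta>)"
proof -
  have pos: "\<alpha> > 0" "\<beta> > 0"
    using sm sc by (auto simp: smooth_def strongly_convex_def)
  have attained: "\<exists>X. (\<forall>x. g X - u \<bullet> X \<le> g x - u \<bullet> x) \<and> fenchel_conjugate g u = u \<bullet> X - g X" for u
  proof -
    obtain X where X: "\<And>x. g X - u \<bullet> X \<le> g x - u \<bullet> x"
      using strongly_convex_attains_min[OF strongly_convex_diff_inner[OF sc, of u]] by metis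
    have "fenchel_conjugate g u = u \<bullet> X - g X"
      unfolding fenchel_conjugate_def
    proof (rule cSup_eq_maximum)
      fix y assume "y \<in> range (\<lambda>x. u \<bullet> x - g x)"
      then show "y \<le> u \<bullet> X - g X"
        using X by (fastforce simp: algebra_simps)
    qed auto
    then show ?thesis
      using X by blast
  qed
  have conj_ge: "u \<bullet> x - g x \<le> fenchel_conjugate g u" for u x
    using attained[of u] by (smt (verit))
  obtain X where X: "\<And>x. g X - u \<bullet> X \<le> g x - u \<bullet> x" and eq: "fenchel_conjugate g u = u \<bullet> X - g X"
    using attained by blast
  show thesis
  proof (intro that[OF eq] allI)
    fix u'
    \<comment> \<open>This \<open>z\<close> maximizes the guaranteed gain
      \<open>(u' - u) \<bullet> z - \<alpha> / 2 * (norm z)\<^sup>2\<close>.\<close>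
    define z where "z = (1 / \<alpha>) *\<^sub>R (u' - u)"
    have "g (X + z) \<le> g X + u \<bullet> z + \<alpha> / 2 * (norm z)\<^sup>2"
      using X by (intro smooth_subgradient_growth[OF sm]) (simp add: inner_diff_right algebra_simps)
    moreover have "\<alpha> / 2 * (norm z)\<^sup>2 = (norm (u' - u))\<^sup>2 / (2 * \<alpha>)"
      "(u' - u) \<bullet> z = (norm (u' - u))\<^sup>2 / \<alpha>"
      using pos by (simp_all add: z_def power_divide power2_eq_square dot_square_norm)
    ultimately show "fenchel_conjugate g u + (u' - u) \<bullet> X + (norm (u' - u))\<^sup>2 / (2 * \<alpha>) \<le> fenchel_conjugate g u'"
      using conj_ge[of u' "X + z"] eq by (simp add: inner_simps)
  next
    fix u'
    obtain Y where Y: "fenchel_conjugate g u' = u' \<bullet> Y - g Y"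
      using attained by blast
    define e where "e = u' - u"
    define y where "y = Y - X"
    have "g X - u \<bullet> X + \<beta> / 2 * (norm y)\<^sup>2 \<le> g Y - u \<bullet> Y"
      unfolding y_def
      by (intro strongly_convex_min_growth[OF strongly_convex_diff_inner[OF sc, of u]] X)
    then have "fenchel_conjugate g u' \<le> fenchel_conjugate g u + e \<bullet> X + (e \<bullet> y - \<beta> / 2 * (norm y)\<^sup>2)"
      by (simp add: Y eq e_def y_def inner_simps)
    moreover have "e \<bullet> y - \<beta> / 2 * (norm y)\<^sup>2 \<le> (norm e)\<^sup>2 / (2 * \<beta>)"
    proof -
      \<comment> \<open>Completing the square in \<open>y\<close>, after scaling by
        \<open>2 * \<beta>\<close>.\<close>
      have "0 \<le> (norm (e - \<beta> *\<^sub>R y))\<^sup>2"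
        by simp
      also have "\<dots> = (norm e)\<^sup>2 - 2 * \<beta> * (e \<bullet> y) + \<beta>\<^sup>2 * (norm y)\<^sup>2"
        unfolding power2_norm_eq_inner
        by (simp add: inner_simps inner_commute power2_eq_square algebra_simps)
      finally show ?thesis
        using pos by (simp add: field_simps power2_eq_square)
    qed
    ultimately show "fenchel_conjugate g u' \<le> fenchel_conjugate g u + (u' - u) \<bullet> X + (norm (u' - u))\<^sup>2 / (2 * \<beta>)"
      by (simp add: e_def)
  qed
qed

section \<open>Differentiability of the dual objective\<close>

lemma quadratic_bounds_imp_GDERIV:
  fixes h :: "'a::real_inner \<Rightarrow> real"
  assumes up: "\<And>u. h u \<le> h w + (u - w) \<bullet> y"
    and lo: "\<And>u. h u \<ge> h w + (u - w) \<bullet> y - C * (norm (u - w))\<^sup>2"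
  shows "GDERIV h w :> y"
  unfolding gderiv_def has_derivative_at_alt
proof (intro conjI allI impI)
  show "bounded_linear (\<lambda>h. h \<bullet> y)"
    by (rule bounded_linear_inner_left)
  fix e :: real assume e: "e > 0"
  show "\<exists>d>0. \<forall>u. norm (u - w) < d \<longrightarrow> norm (h u - h w - (u - w) \<bullet> y) \<le> e * norm (u - w)"
  proof (intro exI conjI allI impI)
    show "e / (\<bar>C\<bar> + 1) > 0"
      using e by simp
    fix u assume "norm (u - w) < e / (\<bar>C\<bar> + 1)"
    then have "(\<bar>C\<bar> + 1) * norm (u - w) \<le> e"
      by (simp add: pos_less_divide_eq mult.commute)
    then have "(\<bar>C\<bar> + 1) * norm (u - w) * norm (u - w) \<le> e * norm (u - w)"
      by (intro mult_right_mono) auto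
    moreover have "C * (norm (u - w))\<^sup>2 \<le> (\<bar>C\<bar> + 1) * (norm (u - w))\<^sup>2"
      by (intro mult_right_mono) auto
    ultimately have "C * (norm (u - w))\<^sup>2 \<le> e * norm (u - w)"
      unfolding power2_eq_square mult.assoc by (rule order_trans[rotated])
    then show "norm (h u - h w - (u - w) \<bullet> y) \<le> e * norm (u - w)"
      using up[of u] lo[of u] unfolding real_norm_def by linarith
  qed
qed

text \<open>Identifies the gradient \<open>x i\<close> supplied by a run with the vector in the
  quadratic bounds.\<close>

lemma GDERIV_unique:
  assumes "GDERIV h w :> x" "GDERIV h w :> y"
  shows "x = y"
proof -
  have "(\<lambda>d. d \<bullet> x) = (\<lambda>d. d \<bullet> y)"
    using assms unfolding gderiv_def by (rule has_derivative_unique)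
  then have "(x - y) \<bullet> x = (x - y) \<bullet> y"
    by (rule fun_cong)
  then have "(x - y) \<bullet> (x - y) = 0"
    by (simp add: inner_diff_right)
  then show ?thesis
    by simp
qed

text \<open>The two reflections cancel in the gradient: \<open>y\<close> is the maximizer defining
  the conjugate at \<open>- w\<close>, hence a primal point.\<close>

lemma dual_objective_gradient:
  fixes g :: "'a::euclidean_space \<Rightarrow> real"
  assumes "smooth \<alpha> g" "strongly_convex \<beta> g" and h: "h = (\<lambda>u. - fenchel_conjugate g (- u))"
  obtains y where "GDERIV h w :> y" "h w = w \<bullet> y + g y"
    "\<forall>u. h u \<le> h w + (u - w) \<bullet> y - (norm (u - w))\<^sup>2 / (2 * \<alpha>)"
    "\<forall>u. h u \<ge> h w + (u - w) \<bullet> y - (norm (u - w))\<^sup>2 / (2 * \<beta>)"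
proof -
  obtain y where eq: "fenchel_conjugate g (- w) = (- w) \<bullet> y - g y"
    and lo: "\<forall>u. fenchel_conjugate g (- w) + (u - - w) \<bullet> y + (norm (u - - w))\<^sup>2 / (2 * \<alpha>)
          \<le> fenchel_conjugate g u"
    and up: "\<forall>u. fenchel_conjugate g u
          \<le> fenchel_conjugate g (- w) + (u - - w) \<bullet> y + (norm (u - - w))\<^sup>2 / (2 * \<beta>)"
    using assms(1,2) by (rule fenchel_conjugate_bounds)
  have norm_flip: "norm (- u - - w) = norm (u - w)" for u
    by (simp add: norm_minus_commute)
  have h_lo: "h u \<ge> h w + (u - w) \<bullet> y - (norm (u - w))\<^sup>2 / (2 * \<beta>)" for u
    using up[rule_format, of "- u"] unfolding norm_flip by (simp add: h inner_simps)
  have h_up: "h u \<le> h w + (u - w) \<bullet> y - (norm (u - w))\<^sup>2 / (2 * \<alpha>)" for u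
    using lo[rule_format, of "- u"] unfolding norm_flip by (simp add: h inner_simps)
  have "GDERIV h w :> y"
  proof (rule quadratic_bounds_imp_GDERIV)
    fix u
    have "(norm (u - w))\<^sup>2 / (2 * \<alpha>) \<ge> 0"
      using assms(1) by (auto simp: smooth_def)
    then show "h u \<le> h w + (u - w) \<bullet> y"
      using h_up[of u] by simp
    show "h u \<ge> h w + (u - w) \<bullet> y - 1 / (2 * \<beta>) * (norm (u - w))\<^sup>2"
      using h_lo[of u] by simp
  qed
  moreover have "h w = w \<bullet> y + g y"
    using eq by (simp add: h)
  ultimately show thesis
    using h_up h_lo by (intro that allI)
qed

section \<open>The base polytope\<close>

lemma polytope_base_polytope:
  fixes F :: "'n::finite set \<Rightarrow> real"
  shows "polytope (base_polytope F)"
proof -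
  have eq: "(\<Sum>k\<in>A. w $ k) = (\<Sum>k\<in>A. axis k 1) \<bullet> w" for A and w :: "real ^ 'n"
    by (simp add: inner_sum_left inner_axis')
  have "polyhedron {w :: real ^ 'n. (\<Sum>k\<in>A. w $ k) \<le> c}"
    "polyhedron {w :: real ^ 'n. (\<Sum>k\<in>A. w $ k) = c}" for A c
    unfolding eq by (rule polyhedron_halfspace_le polyhedron_hyperplane)+
  moreover have "base_polytope F =
      \<Inter> ((\<lambda>A. {w. (\<Sum>k\<in>A. w $ k) \<le> F A}) ` UNIV) \<inter> {w. (\<Sum>k\<in>UNIV. w $ k) = F UNIV}"
    by (auto simp: base_polytope_def)
  ultimately have "polyhedron (base_polytope F)"
    by (auto intro!: polyhedron_Inter polyhedron_Int)
  moreover have "bounded (base_polytope F)"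
  proof (rule bounded_subset[OF bounded_cbox])
    \<comment> \<open>Upper bounds are the singleton constraints; lower bounds subtract the
      constraint for the complement of \<open>k\<close> from the equality for the total.\<close>
    show "base_polytope F \<subseteq> cbox (\<chi> k. F UNIV - F (UNIV - {k})) (\<chi> k. F {k})"
    proof
      fix w assume w: "w \<in> base_polytope F"
      have "w $ k \<le> F {k}" "F UNIV - F (UNIV - {k}) \<le> w $ k" for k
      proof -
        have "(\<Sum>j\<in>{k}. w $ j) \<le> F {k}" "(\<Sum>j\<in>UNIV - {k}. w $ j) \<le> F (UNIV - {k})"
          "(\<Sum>j\<in>UNIV. w $ j) = F UNIV"
          using w unfolding base_polytope_def by blast+
        moreover have "(\<Sum>j\<in>UNIV. w $ j) = w $ k + (\<Sum>j\<in>UNIV - {k}. w $ j)"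
          by (simp add: sum.remove)
        ultimately show "w $ k \<le> F {k}" "F UNIV - F (UNIV - {k}) \<le> w $ k"
          by simp_all
      qed
      then show "w \<in> cbox (\<chi> k. F UNIV - F (UNIV - {k})) (\<chi> k. F {k})"
        by (simp add: mem_box_cart)
    qed
  qed
  ultimately show ?thesis
    by (simp add: polytope_eq_bounded_polyhedron)
qed

lemma finite_vert:
  fixes P :: "'a::euclidean_space set"
  assumes "polytope P"
  shows "finite (vert P)"
  using assms finite_polyhedron_extreme_points polytope_imp_polyhedron
  by (auto simp: vert_def)

lemma vert_subset: "vert P \<subseteq> P"
  by (auto simp: vert_def extreme_point_of_def)

lemma convex_hull_vert:
  fixes P :: "'a::euclidean_space set"
  assumes "polytope P"
  shows "convex hull (vert P) = P"
  using Krein_Milman_Minkowski[OF polytope_imp_compact[OF assms] polytope_imp_convex[OF assms]]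
  by (simp add: vert_def)

lemma face_vert:
  assumes "K face_of P"
  shows "K \<inter> vert P = vert K"
  using extreme_point_of_face[OF assms] by (auto simp: vert_def)

section \<open>Pyramidal width\<close>

text \<open>A mean with positive weights that no value exceeds equals every value. Applied with the
  gradient as \<open>n\<close> to get the level set, and with a projection residual to place active
  vertices in a face.\<close>

lemma convex_combination_maximal_level:
  fixes w :: "'a::real_inner"
  assumes fin: "finite A" and c: "\<And>a. a \<in> A \<Longrightarrow> c a > 0" "sum c A = 1"
    and w: "w = (\<Sum>a\<in>A. c a *\<^sub>R a)"
    and le: "\<And>a. a \<in> A \<Longrightarrow> n \<bullet> a \<le> n \<bullet> w" and a: "a \<in> A"
  shows "n \<bullet> a = n \<bullet> w"
proof -
  have "(\<Sum>b\<in>A. c b * (n \<bullet> w - n \<bullet> b)) = sum c A * (n \<bullet> w) - n \<bullet> (\<Sum>b\<in>A. c b *\<^sub>R b)"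
    by (simp add: right_diff_distrib sum_subtractf sum_distrib_right inner_sum_right)
  also have "\<dots> = 0"
    by (simp add: c(2) flip: w)
  finally have "(\<Sum>b\<in>A. c b * (n \<bullet> w - n \<bullet> b)) = 0" .
  moreover have "0 \<le> c b * (n \<bullet> w - n \<bullet> b)" if "b \<in> A" for b
    using c(1)[OF that] le[OF that] by simp
  ultimately have "c a * (n \<bullet> w - n \<bullet> a) = 0"
    using sum_nonneg_eq_0_iff[OF fin, of "\<lambda>b. c b * (n \<bullet> w - n \<bullet> b)"] a by simp
  then show ?thesis
    using c(1)[OF a] by simp
qed

section \<open>Bounds for the width functionals\<close>

lemma finite_pairwise_quotients:
  assumes "finite P"
  shows "finite {((v - w) \<bullet> x) / norm x | v w. v \<in> P \<and> w \<in> P}"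
proof -
  have "{((v - w) \<bullet> x) / norm x | v w. v \<in> P \<and> w \<in> P} =
      (\<lambda>(v, w). ((v - w) \<bullet> x) / norm x) ` (P \<times> P)"
    by auto
  then show ?thesis
    using assms by simp
qed

lemma dirW_nonneg:
  assumes "finite P" "P \<noteq> {}"
  shows "dirW P x \<ge> 0"
proof -
  obtain p where "p \<in> P"
    using assms by auto
  then have "0 \<in> {((v - w) \<bullet> x) / norm x | v w. v \<in> P \<and> w \<in> P}"
    by force
  then show ?thesis
    unfolding dirW_def
    using assms by (intro cSup_upper bdd_above_finite finite_pairwise_quotients)
qed

lemma dirW_le:
  assumes "P \<noteq> {}" "\<And>v w. v \<in> P \<Longrightarrow> w \<in> P \<Longrightarrow> ((v - w) \<bullet> x) / norm x \<le> c"
  shows "dirW P x \<le> c"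
  unfolding dirW_def
proof (rule cSup_least)
  obtain p where "p \<in> P"
    using assms by auto
  then show "{((v - w) \<bullet> x) / norm x | v w. v \<in> P \<and> w \<in> P} \<noteq> {}"
    by blast
qed (use assms in auto)

text \<open>\<open>arg_max_on\<close> is a choice operator; the hypotheses ensure that there is a
  maximizer to choose.\<close>

lemma arg_max_on_mem:
  fixes f :: "'a \<Rightarrow> real"
  assumes "finite V" "V \<noteq> {}"
  shows "arg_max_on f V \<in> V" "y \<in> V \<Longrightarrow> f y \<le> f (arg_max_on f V)"
proof -
  obtain m where "m \<in> V" "f m = Max (f ` V)"
    using Max_in[of "f ` V"] assms by fastforce
  then have m: "m \<in> V" "\<And>y. y \<in> V \<Longrightarrow> \<not> f m < f y"
    using assms by (auto simp: not_less)
  have "arg_max_on f V \<in> V \<and> (\<forall>y. y \<in> V \<longrightarrow> \<not> f (arg_max_on f V) < f y)"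
    unfolding arg_max_on_def
    by (rule arg_maxI[of "\<lambda>x. x \<in> V" m f]) (use m in auto)
  then show "arg_max_on f V \<in> V" "y \<in> V \<Longrightarrow> f y \<le> f (arg_max_on f V)"
    by (auto simp: not_less)
qed

text \<open>Keeps the infimum in \<open>PdirW\<close> from ranging over the empty set, where its
  value would be arbitrary.\<close>

lemma active_sets_nonempty:
  assumes "finite V" "w \<in> convex hull V"
  shows "active_sets V w \<noteq> {}"
proof -
  obtain c where c: "\<forall>v\<in>V. 0 \<le> c v" "sum c V = (1::real)" "(\<Sum>v\<in>V. c v *\<^sub>R v) = w"
    using assms by (auto simp: convex_hull_finite)
  define A where "A = {v \<in> V. c v \<noteq> 0}"
  have "sum c A = sum c V" "(\<Sum>v\<in>A. c v *\<^sub>R v) = (\<Sum>v\<in>V. c v *\<^sub>R v)"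
    unfolding A_def using assms(1) by (auto intro!: sum.mono_neutral_left)
  then have "sum c A = 1" "w = (\<Sum>v\<in>A. c v *\<^sub>R v)"
    using c(2,3) by simp_all
  then have "A \<in> active_sets V w"
    using c(1) by (auto simp: active_sets_def A_def)
  then show ?thesis
    by blast
qed

text \<open>Provides the lower bound that makes the real infimum in \<open>PdirW\<close> lie below
  its members.\<close>

lemma dirW_active_nonneg:
  assumes "finite V" "A \<in> active_sets V w"
  shows "dirW (A \<union> {s}) x \<ge> 0"
  using assms finite_subset by (intro dirW_nonneg) (auto simp: active_sets_def)

lemma PdirW_nonneg:
  assumes "finite V" "w \<in> convex hull V"
  shows "PdirW V x w \<ge> 0"
  unfolding PdirW_def
  using active_sets_nonempty[OF assms] dirW_active_nonneg[OF assms(1)] by (intro cINF_greatest)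

lemma PdirW_le_dirW:
  assumes "finite V" "A \<in> active_sets V w"
  shows "PdirW V x w \<le> dirW (A \<union> {arg_max_on (\<lambda>v. v \<bullet> x) V}) x"
  unfolding PdirW_def
  using assms dirW_active_nonneg[OF assms(1)] by (intro cINF_lower bdd_belowI2[of _ 0]) auto

lemma PdirW_face_nonneg:
  fixes P :: "'a::euclidean_space set"
  assumes "polytope P" "K face_of P" "w \<in> K"
  shows "PdirW (K \<inter> vert P) x w \<ge> 0"
proof -
  have "polytope K"
    using assms face_of_polytope_polytope by blast
  then show ?thesis
    unfolding face_vert[OF assms(2)]
    using assms(3) by (intro PdirW_nonneg) (auto simp: finite_vert convex_hull_vert)
qed

lemma PWidth_le_PdirW:
  fixes P :: "'a::euclidean_space set"
  assumes "polytope P" "K face_of P" "w \<in> K" "x \<in> cone hull ((\<lambda>y. y - w) ` K) - {0}"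
  shows "PWidth P \<le> PdirW (K \<inter> vert P) x w"
  unfolding PWidth_def
proof (rule cInf_lower)
  show "bdd_below {PdirW (K \<inter> vert P) x w | K x w.
     K face_of P \<and> w \<in> K \<and> x \<in> cone hull ((\<lambda>y. y - w) ` K) - {0}}"
    using PdirW_face_nonneg[OF assms(1)] by (intro bdd_belowI[of _ 0]) blast
qed (use assms in blast)

text \<open>The hypotheses on \<open>K\<close>, \<open>w\<close> and \<open>x\<close> exhibit one
  admissible triple, so the infimum is not over the empty set.\<close>

lemma PWidth_nonneg:
  fixes P :: "'a::euclidean_space set"
  assumes "polytope P" "K face_of P" "w \<in> K" "x \<in> cone hull ((\<lambda>y. y - w) ` K) - {0}"
  shows "PWidth P \<ge> 0"
  unfolding PWidth_def
  by (rule cInf_greatest) (use assms PdirW_face_nonneg[OF assms(1)] in blast)+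

section \<open>Cones of feasible directions\<close>

lemma closed_cone_of_directions:
  fixes P :: "'a::euclidean_space set"
  assumes "polytope P" "P \<noteq> {}"
  shows "closed (cone hull ((\<lambda>y. y - w) ` P))" "convex (cone hull ((\<lambda>y. y - w) ` P))"
proof -
  let ?S = "(\<lambda>y. y - w) ` P"
  have "polytope ?S"
    using assms polytope_translation_eq[of "- w" P] by (simp add: add.commute[of "- w"])
  then have "convex ?S"
    by (rule polytope_imp_convex)
  \<comment> \<open>For a nonempty convex set the cone hull is already the convex cone hull; for a
    polytope the latter is polyhedral, hence closed.\<close>
  then have eq: "convex_cone hull ?S = cone hull ?S"
    using assms convex_hull_eq
    by (subst convex_cone_hull_separate_nonempty)
      (auto simp: conic_hull_explicit cone_hull_expl hull_same)
  then show "closed (cone hull ?S)"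
    using polyhedron_convex_cone_hull_polytope[OF \<open>polytope ?S\<close>] polyhedron_imp_closed by metis
  show "convex (cone hull ?S)"
    using convex_convex_cone_hull[of ?S] eq by simp
qed

lemma Moreau_cone_projection:
  fixes C :: "'a::euclidean_space set"
  assumes "closed C" "convex C" "cone C" "C \<noteq> {}"
  obtains r' where "r' \<in> C" "(r - r') \<bullet> r' = 0" "\<And>y. y \<in> C \<Longrightarrow> (r - r') \<bullet> y \<le> 0"
proof -
  let ?r = "closest_point C r"
  have mem: "?r \<in> C"
    using assms by (intro closest_point_in_set)
  have dot: "(r - ?r) \<bullet> (y - ?r) \<le> 0" if "y \<in> C" for y
    using closest_point_dot assms that by blast
  \<comment> \<open>Testing the obtuse-angle condition with these two points gives both signs, hence
    orthogonality.\<close>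
  have "2 *\<^sub>R ?r \<in> C" "0 *\<^sub>R ?r \<in> C"
    using assms(3) mem unfolding cone_def by (meson order_refl zero_le_numeral)+
  from this[THEN dot] have orth: "(r - ?r) \<bullet> ?r = 0"
    by (simp add: scaleR_2)
  show thesis
    using mem orth dot by (intro that) (auto simp: inner_diff_right)
qed

text \<open>The angle lemma of Lacoste-Julien and Jaggi, in the case where the active set \<open>A\<close> lies in a
  level set of \<open>r\<close>. With \<open>r'\<close> the projection of \<open>r\<close> onto the cone of feasible directions at \<open>w\<close>,
  the residual \<open>r - r'\<close> exposes a face that contains \<open>A\<close> and on which \<open>r\<close> and \<open>r'\<close> differ by a
  constant.\<close>

lemma PWidth_bound:
  fixes P :: "'a::euclidean_space set"
  assumes P: "polytope P" and w: "w \<in> P" and u: "u \<in> P" and pos: "r \<bullet> (u - w) > 0"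
    and A: "A \<in> active_sets (vert P) w" and level: "\<And>a. a \<in> A \<Longrightarrow> r \<bullet> a = r \<bullet> w"
    and v: "\<And>y. y \<in> P \<Longrightarrow> r \<bullet> y \<le> r \<bullet> v"
  shows "0 \<le> PWidth P" "PWidth P \<le> diameter P"
    "PWidth P * (r \<bullet> (u - w)) \<le> r \<bullet> (v - w) * norm (u - w)"
proof -
  define C where "C = cone hull ((\<lambda>y. y - w) ` P)"
  have dirs: "y - w \<in> C" if "y \<in> P" for y
    using that by (auto simp: C_def intro: hull_inc)
  have C: "closed C" "convex C" "cone C" "C \<noteq> {}"
    using closed_cone_of_directions[OF P] w dirs by (auto simp: C_def cone_cone_hull)
  obtain r' where r': "r' \<in> C" "(r - r') \<bullet> r' = 0" and polar: "\<And>y. y \<in> C \<Longrightarrow> (r - r') \<bullet> y \<le> 0"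
    using Moreau_cone_projection[OF C] by metis
  define n where "n = r - r'"
  define K where "K = P \<inter> {y. n \<bullet> y = n \<bullet> w}"
  have n_le: "n \<bullet> y \<le> n \<bullet> w" if "y \<in> P" for y
    using polar[OF dirs[OF that]] by (simp add: n_def inner_diff_right)
  have "convex P"
    using P polytope_imp_convex by blast
  then have K: "K face_of P"
    unfolding K_def using n_le by (rule face_of_Int_supporting_hyperplane_le)
  have wK: "w \<in> K"
    using w by (simp add: K_def)
  \<comment> \<open>The residual is nonpositive on the feasible direction \<open>u - w\<close>, so
    replacing \<open>r\<close> by \<open>r'\<close> can only increase the product. With
    \<open>pos\<close> this also forces \<open>r'\<close> to be nonzero.\<close>
  have "r \<bullet> (u - w) \<le> r' \<bullet> (u - w)"
    using polar[OF dirs[OF u]] by (simp add: inner_diff_left)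
  also have "\<dots> \<le> norm r' * norm (u - w)"
    by (rule norm_cauchy_schwarz)
  finally have r_le: "r \<bullet> (u - w) \<le> norm r' * norm (u - w)" .
  have "r' \<noteq> 0"
    using r_le pos by auto
  \<comment> \<open>\<open>r'\<close> is a multiple of some \<open>y - w\<close>; its orthogonality
    to \<open>n\<close> puts \<open>y\<close> on the exposed face, so \<open>r'\<close> is a
    feasible direction of \<open>K\<close> itself.\<close>
  have r'K: "r' \<in> cone hull ((\<lambda>y. y - w) ` K) - {0}"
  proof -
    obtain c y where cy: "r' = c *\<^sub>R (y - w)" "c \<ge> 0" "y \<in> P"
      using r'(1) by (auto simp: C_def cone_hull_expl)
    then have "n \<bullet> y = n \<bullet> w"
      using r'(2) \<open>r' \<noteq> 0\<close> by (auto simp: n_def inner_diff_right)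
    then have "y \<in> K"
      using cy by (simp add: K_def)
    then show ?thesis
      using cy \<open>r' \<noteq> 0\<close> by (auto simp: cone_hull_expl)
  qed
  have fin: "finite (K \<inter> vert P)"
    using finite_vert[OF P] by simp
  have A_sub: "A \<subseteq> vert P"
    using A by (simp add: active_sets_def)
  obtain c where c: "\<And>a. a \<in> A \<Longrightarrow> c a > 0" "sum c A = 1" "w = (\<Sum>a\<in>A. c a *\<^sub>R a)"
    using A by (auto simp: active_sets_def less_le)
  have "finite A"
    using A_sub finite_vert[OF P] finite_subset by blast
  have AK: "A \<subseteq> K"
  proof
    fix a assume "a \<in> A"
    then have "n \<bullet> a = n \<bullet> w"
      using convex_combination_maximal_level[OF \<open>finite A\<close> c] n_le A_sub vert_subset[of P] by blast
    then show "a \<in> K"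
      using \<open>a \<in> A\<close> A_sub vert_subset[of P] by (auto simp: K_def)
  qed
  have AV: "A \<subseteq> K \<inter> vert P"
    using AK A_sub by blast
  then have act: "A \<in> active_sets (K \<inter> vert P) w"
    using A by (auto simp: active_sets_def)
  have "A \<noteq> {}"
    using c(2) by auto
  define s where "s = arg_max_on (\<lambda>v. v \<bullet> r') (K \<inter> vert P)"
  have "K \<inter> vert P \<noteq> {}"
    using AV \<open>A \<noteq> {}\<close> by blast
  then have sK: "s \<in> K \<inter> vert P" and s_max: "\<And>y. y \<in> K \<inter> vert P \<Longrightarrow> y \<bullet> r' \<le> s \<bullet> r'"
    using arg_max_on_mem[OF fin, where f = "\<lambda>v. v \<bullet> r'"] unfolding s_def by simp_all
  have diff: "y \<bullet> r' - w \<bullet> r' = r \<bullet> (y - w)" if "y \<in> K" for y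
    using that by (simp add: K_def n_def inner_simps inner_commute)
  have width: "PWidth P \<le> dirW (A \<union> {s}) r'"
    using PWidth_le_PdirW[OF P K wK r'K] PdirW_le_dirW[OF fin act] unfolding s_def
    by (rule order_trans)
  show "0 \<le> PWidth P"
    using PWidth_nonneg[OF P K wK r'K] .
  have "dirW (A \<union> {s}) r' \<le> diameter P"
  proof (rule dirW_le)
    fix p q assume "p \<in> A \<union> {s}" "q \<in> A \<union> {s}"
    then have "p \<in> P" "q \<in> P"
      using A_sub sK vert_subset[of P] by auto
    then have "norm (p - q) \<le> diameter P"
      using diameter_bounded_bound[of P p q] polytope_imp_bounded[OF P] by (simp add: dist_norm)
    moreover have "(p - q) \<bullet> r' \<le> norm (p - q) * norm r'"
      by (rule norm_cauchy_schwarz)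
    ultimately show "((p - q) \<bullet> r') / norm r' \<le> diameter P"
      using \<open>r' \<noteq> 0\<close> by (smt (verit) pos_divide_le_eq mult_right_mono norm_ge_zero zero_less_norm_iff)
  qed auto
  then show "PWidth P \<le> diameter P"
    using width by simp
  have "dirW (A \<union> {s}) r' \<le> (r \<bullet> (v - w)) / norm r'"
  proof (rule dirW_le)
    fix p q assume pq: "p \<in> A \<union> {s}" "q \<in> A \<union> {s}"
    \<comment> \<open>On \<open>A\<close> the functional \<open>r'\<close> is constant with its
      value at \<open>w\<close>, so over \<open>A \<union> {s}\<close> it ranges between
      \<open>w\<close> and \<open>s\<close>.\<close>
    have A_level: "a \<bullet> r' = w \<bullet> r'" if "a \<in> A" for a
      using diff[of a] level[of a] AK that by (auto simp: inner_diff_right)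
    have "s \<bullet> r' \<ge> w \<bullet> r'"
      using \<open>A \<noteq> {}\<close> A_level s_max AV by (metis all_not_in_conv subsetD)
    then have "p \<bullet> r' \<le> s \<bullet> r'" "q \<bullet> r' \<ge> w \<bullet> r'"
      using pq A_level by auto
    then have "(p - q) \<bullet> r' \<le> s \<bullet> r' - w \<bullet> r'"
      by (simp add: inner_diff_left)
    also have "\<dots> = r \<bullet> (s - w)"
      using sK by (intro diff) auto
    also have "\<dots> \<le> r \<bullet> (v - w)"
      using v[of s] sK vert_subset[of P] by (auto simp: inner_diff_right)
    finally show "((p - q) \<bullet> r') / norm r' \<le> (r \<bullet> (v - w)) / norm r'"
      by (simp add: divide_right_mono)
  qed auto
  with width have "PWidth P \<le> (r \<bullet> (v - w)) / norm r'"
    by (rule order_trans)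
  then have "PWidth P * norm r' \<le> r \<bullet> (v - w)"
    using \<open>r' \<noteq> 0\<close> by (simp add: pos_le_divide_eq)
  then have "PWidth P * norm r' * norm (u - w) \<le> r \<bullet> (v - w) * norm (u - w)"
    by (rule mult_right_mono) simp
  moreover have "PWidth P * (r \<bullet> (u - w)) \<le> PWidth P * (norm r' * norm (u - w))"
    using r_le \<open>0 \<le> PWidth P\<close> by (rule mult_left_mono)
  ultimately show "PWidth P * (r \<bullet> (u - w)) \<le> r \<bullet> (v - w) * norm (u - w)"
    by (simp add: mult.assoc)
qed

section \<open>Duality and the linear rate\<close>

text \<open>First-order optimality: moving a fraction s towards \<open>u\<close> stays in
  \<open>S\<close> and cannot raise \<open>h\<close>, so the slope is at most of order s. Applied
  both to the hull of the current vertices and to the whole polytope.\<close>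

lemma maximizer_imp_supporting:
  fixes y :: "'a::real_inner"
  assumes lo: "\<And>u. h u \<ge> h w + (u - w) \<bullet> y - (norm (u - w))\<^sup>2 / (2 * \<beta>)"
    and S: "convex S" "w \<in> S" "u \<in> S" and max: "\<And>u. u \<in> S \<Longrightarrow> h u \<le> h w"
  shows "u \<bullet> y \<le> w \<bullet> y"
proof -
  have "(u - w) \<bullet> y \<le> 0 + s * ((norm (u - w))\<^sup>2 / (2 * \<beta>))" if s: "0 < s" "s < 1" for s
  proof -
    have "w + s *\<^sub>R (u - w) = (1 - s) *\<^sub>R w + s *\<^sub>R u"
      by (simp add: algebra_simps)
    then have "w + s *\<^sub>R (u - w) \<in> S"
      using S s by (simp add: convexD)
    then have "s * ((u - w) \<bullet> y) \<le> s * (s * ((norm (u - w))\<^sup>2 / (2 * \<beta>)))"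
      using max[of "w + s *\<^sub>R (u - w)"] lo[of "w + s *\<^sub>R (u - w)"]
      by (simp add: power_mult_distrib power2_eq_square mult_ac)
    then have "(u - w) \<bullet> y \<le> s * ((norm (u - w))\<^sup>2 / (2 * \<beta>))"
      by (rule mult_left_le_imp_le) (use s in simp)
    then show ?thesis
      by simp
  qed
  then have "(u - w) \<bullet> y \<le> 0"
    by (rule le_of_le_add_small)
  then show ?thesis
    by (simp add: inner_diff_left)
qed

text \<open>The gradient \<open>y\<close> at the dual maximizer \<open>ws\<close> is an optimal
  primal point: by first-order optimality \<open>ws\<close> also maximizes the linear functional
  \<open>y\<close> over the polytope, so the primal value at \<open>y\<close> equals
  \<open>h ws\<close>.\<close>

lemma strong_duality:
  fixes g h :: "real ^ 'n \<Rightarrow> real"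
  assumes sm: "smooth \<alpha> g" and sc: "strongly_convex \<beta> g"
    and h: "h = (\<lambda>u. - fenchel_conjugate g (- u))" and ne: "base_polytope F \<noteq> {}"
  obtains ws where "ws \<in> base_polytope F" "(INF y. lovasz_extension F y + g y) \<le> h ws"
proof -
  let ?P = "base_polytope F"
  have comp: "compact ?P" and conv: "convex ?P"
    using polytope_base_polytope polytope_imp_compact polytope_imp_convex by blast+
  have "isCont h w" for w
  proof -
    obtain y where "GDERIV h w :> y"
      using sm sc h by (rule dual_objective_gradient)
    then show ?thesis
      unfolding gderiv_def by (rule has_derivative_continuous)
  qed
  then have "continuous_on ?P h"
    by (simp add: continuous_at_imp_continuous_on)
  then obtain ws where ws: "ws \<in> ?P" "\<And>u. u \<in> ?P \<Longrightarrow> h u \<le> h ws"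
    using continuous_attains_sup[OF comp ne] by blast
  obtain y where y: "h ws = ws \<bullet> y + g y"
    "\<forall>u. h u \<ge> h ws + (u - ws) \<bullet> y - (norm (u - ws))\<^sup>2 / (2 * \<beta>)"
    using sm sc h by (rule dual_objective_gradient)
  have sup: "u \<bullet> y \<le> ws \<bullet> y" if "u \<in> ?P" for u
    using maximizer_imp_supporting[OF y(2)[rule_format] conv ws(1) that ws(2)] .
  have "lovasz_extension F y = ws \<bullet> y"
    unfolding lovasz_extension_def by (rule cSup_eq_maximum) (use ws(1) sup in auto)
  \<comment> \<open>Weak duality bounds the primal values from below, so that their infimum lies
    below the value at \<open>y\<close>.\<close>
  moreover have "h ws \<le> lovasz_extension F z + g z" for z
  proof -
    have "bdd_above ((\<lambda>u. u \<bullet> z) ` ?P)"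
      using comp by (intro compact_imp_bounded[THEN bounded_imp_bdd_above] compact_continuous_image
          continuous_intros)
    then have "ws \<bullet> z \<le> lovasz_extension F z"
      unfolding lovasz_extension_def using ws(1) by (rule cSUP_upper2) simp
    moreover have "h ws \<le> ws \<bullet> z + g z"
    proof -
      obtain X where X: "\<And>x. g X - (- ws) \<bullet> X \<le> g x - (- ws) \<bullet> x"
        using strongly_convex_attains_min[OF strongly_convex_diff_inner[OF sc, of "- ws"]] by metis
      have "bdd_above (range (\<lambda>x. (- ws) \<bullet> x - g x))"
        using X by (intro bdd_aboveI[of _ "(- ws) \<bullet> X - g X"]) (auto simp: algebra_simps)
      then have "(- ws) \<bullet> z - g z \<le> fenchel_conjugate g (- ws)"
        unfolding fenchel_conjugate_def by (rule cSUP_upper2) auto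
      then show ?thesis
        by (simp add: h)
    qed
    ultimately show ?thesis
      by simp
  qed
  then have "bdd_below (range (\<lambda>y. lovasz_extension F y + g y))"
    by (intro bdd_belowI2)
  then have "(INF y. lovasz_extension F y + g y) \<le> lovasz_extension F y + g y"
    by (rule cINF_lower) simp
  ultimately have "(INF y. lovasz_extension F y + g y) \<le> h ws"
    using y(1) by simp
  with ws(1) show thesis
    by (rule that)
qed

text \<open>Step size \<open>min 1 (\<beta> * gap / M\<^sup>2)\<close> along the Frank-Wolfe direction.\<close>

lemma frank_wolfe_progress:
  fixes r e :: "'a::real_inner" and \<alpha> \<beta> \<delta> M gap \<Delta> \<Delta>' :: real
  assumes pos: "0 < \<beta>" "\<beta> \<le> \<alpha>" "0 \<le> \<delta>" "\<delta> \<le> M" "0 < M" "0 < gap"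
    and subopt: "\<Delta> \<le> r \<bullet> e - (norm e)\<^sup>2 / (2 * \<alpha>)" and gap: "r \<bullet> e \<le> gap"
    and width: "\<delta> * (r \<bullet> e) \<le> gap * norm e"
    and progress: "\<And>\<gamma>. 0 \<le> \<gamma> \<Longrightarrow> \<gamma> \<le> 1 \<Longrightarrow> \<gamma> * gap - \<gamma>\<^sup>2 * M\<^sup>2 / (2 * \<beta>) \<le> \<Delta>'"
  shows "\<beta> / (4 * \<alpha>) * (\<delta> / M)\<^sup>2 * \<Delta> \<le> \<Delta>'"
proof (cases "\<Delta> \<le> 0")
  case True
  have "\<beta> / (4 * \<alpha>) * (\<delta> / M)\<^sup>2 * \<Delta> \<le> 0"
    using True pos by (intro mult_nonneg_nonpos mult_nonneg_nonneg) auto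
  also have "0 \<le> \<Delta>'"
    using progress[of 0] by simp
  finally show ?thesis .
next
  case False
  have \<alpha>: "\<alpha> > 0"
    using pos by simp
  have M2: "M\<^sup>2 > 0"
    using pos by simp
  have "\<Delta> \<le> gap"
  proof -
    have "(norm e)\<^sup>2 / (2 * \<alpha>) \<ge> 0"
      using \<alpha> by simp
    then show ?thesis
      using subopt gap by simp
  qed
  \<comment> \<open>After scaling by \<open>\<delta>\<^sup>2\<close>, the width inequality removes
    \<open>r \<bullet> e\<close>. What remains is a concave quadratic in
    \<open>\<delta> * norm e\<close> with maximum \<open>\<alpha> / 2 * gap\<^sup>2\<close>.\<close>
  have err: "\<delta>\<^sup>2 * \<Delta> \<le> \<alpha> / 2 * gap\<^sup>2"
  proof -
    have "\<delta>\<^sup>2 * \<Delta> \<le> \<delta> * (\<delta> * (r \<bullet> e)) - (\<delta> * norm e)\<^sup>2 / (2 * \<alpha>)"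
      using mult_left_mono[OF subopt, of "\<delta>\<^sup>2"]
      by (simp add: power2_eq_square algebra_simps)
    also have "\<dots> \<le> gap * (\<delta> * norm e) - (\<delta> * norm e)\<^sup>2 / (2 * \<alpha>)"
      using mult_left_mono[OF width, of \<delta>] pos by (simp add: mult_ac)
    also have "\<dots> \<le> \<alpha> / 2 * gap\<^sup>2"
    proof -
      have "0 \<le> (\<alpha> * gap - \<delta> * norm e)\<^sup>2"
        by simp
      then show ?thesis
        using \<alpha> by (simp add: power2_eq_square field_simps)
    qed
    finally show ?thesis .
  qed
  show ?thesis
  proof (cases "\<beta> * gap \<le> M\<^sup>2")
    case True
    \<comment> \<open>This step size maximizes the progress bound and is at most 1 in this
      case.\<close>
    have "\<beta> * gap / M\<^sup>2 * gap - (\<beta> * gap / M\<^sup>2)\<^sup>2 * M\<^sup>2 / (2 * \<beta>) \<le> \<Delta>'"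
      using True pos M2 by (intro progress) auto
    also have "\<beta> * gap / M\<^sup>2 * gap - (\<beta> * gap / M\<^sup>2)\<^sup>2 * M\<^sup>2 / (2 * \<beta>) = \<beta> * gap\<^sup>2 / (2 * M\<^sup>2)"
      using pos by (simp add: power2_eq_square field_simps)
    finally have prog: "\<beta> * gap\<^sup>2 / (2 * M\<^sup>2) \<le> \<Delta>'" .
    have "\<beta> / (4 * \<alpha>) * (\<delta> / M)\<^sup>2 * \<Delta> = \<beta> / (4 * \<alpha> * M\<^sup>2) * (\<delta>\<^sup>2 * \<Delta>)"
      by (simp add: power_divide)
    also have "\<dots> \<le> \<beta> / (4 * \<alpha> * M\<^sup>2) * (\<alpha> / 2 * gap\<^sup>2)"
      using pos \<alpha> M2 by (intro mult_left_mono err) auto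
    also have "\<dots> = 1 / 4 * (\<beta> * gap\<^sup>2 / (2 * M\<^sup>2))"
      using \<alpha> by (simp add: field_simps)
    also have "\<dots> \<le> 1 * (\<beta> * gap\<^sup>2 / (2 * M\<^sup>2))"
      using pos M2 by (intro mult_right_mono divide_nonneg_nonneg) auto
    finally show ?thesis
      using prog by simp
  next
    case False
    have "gap - M\<^sup>2 / (2 * \<beta>) \<le> \<Delta>'"
      using progress[of 1] by simp
    moreover have "M\<^sup>2 / (2 * \<beta>) \<le> gap / 2"
      using False pos by (simp add: field_simps)
    ultimately have "gap / 2 \<le> \<Delta>'"
      by simp
    \<comment> \<open>Here the rate itself must be bounded: it is at most 1/4 because
      \<open>\<beta> \<le> \<alpha>\<close> and \<open>\<delta> \<le> M\<close>.\<close>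
    moreover have "\<beta> / (4 * \<alpha>) * (\<delta> / M)\<^sup>2 * \<Delta> \<le> 1 / 2 * \<Delta>"
    proof (intro mult_right_mono)
      have "\<beta> / (4 * \<alpha>) * (\<delta> / M)\<^sup>2 \<le> 1 / 4 * 1"
        using pos \<alpha> by (intro mult_mono) (auto simp: field_simps intro!: power_le_one)
      then show "\<beta> / (4 * \<alpha>) * (\<delta> / M)\<^sup>2 \<le> 1 / 2"
        by simp
    qed (use \<open>\<not> \<Delta> \<le> 0\<close> in simp)
    ultimately show ?thesis
      using \<open>\<Delta> \<le> gap\<close> by linarith
  qed
qed

theorem theorem5p1:
  fixes F :: "'n::finite set \<Rightarrow> real"
    and g h :: "real ^ 'n \<Rightarrow> real"
    and \<alpha> \<beta> \<epsilon> M \<delta> \<rho> p_star :: real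
    and V B :: "nat \<Rightarrow> (real ^ 'n) set"
    and w x v :: "nat \<Rightarrow> real ^ 'n"
    and lam :: "nat \<Rightarrow> real ^ 'n \<Rightarrow> real"
    and d :: "nat \<Rightarrow> real"
    and N i :: nat
  assumes "submodular F" and "F {} = 0"
    and "smooth \<alpha> g" and "strongly_convex \<beta> g"
    and "h = (\<lambda>u. - fenchel_conjugate g (- u))"
    and "M = diameter (base_polytope F)"
    and "\<delta> = PWidth (base_polytope F)"
    and "\<rho> = \<beta> / (4 * \<alpha>) * (\<delta> / M)\<^sup>2"
    and "p_star = (INF y. lovasz_extension F y + g y)"
    and "\<epsilon> \<ge> 0"
    and "lfcfw_run h F \<epsilon> N V w lam x v B"
    and "d = lfcfw_lower_bound h w"
    and "1 \<le> i" and "i + 1 \<le> N"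
  shows "p_star - d (i + 1) \<le> (1 - \<rho>) * (p_star - d i)"
proof -
  let ?P = "base_polytope F"
  note run = \<open>lfcfw_run h F \<epsilon> N V w lam x v B\<close>[unfolded lfcfw_run_def]
  note run_step = bspec[OF run[THEN conjunct2, THEN conjunct2, THEN conjunct1]]
  note run_update = bspec[OF run[THEN conjunct2, THEN conjunct2, THEN conjunct2]]
  note bounds = \<open>smooth \<alpha> g\<close> \<open>strongly_convex \<beta> g\<close> \<open>h = (\<lambda>u. - fenchel_conjugate g (- u))\<close>
  have P: "polytope ?P"
    by (rule polytope_base_polytope)
  have \<beta>: "\<beta> > 0"
    using bounds(2) by (simp add: strongly_convex_def)
  define A where "A = {u \<in> V (i - 1). lam i u > 0}"
  define r where "r = x i"
  define gap where "gap = v i \<bullet> r - w i \<bullet> r"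
  have V_vert: "V (i - 1) \<subseteq> vert ?P"
  \<comment> \<open>The first iteration uses \<open>V 0\<close>; any later one uses the set
    assembled from vertices in step (4) of iteration \<open>i - 1\<close>.\<close>
  proof (cases "i = 1")
    case True
    then show ?thesis
      using run[THEN conjunct2, THEN conjunct1] by simp
  next
    case False
    then have "i - 1 \<in> {1..<N}" "i - 1 \<in> {1..N}"
      using \<open>1 \<le> i\<close> \<open>i + 1 \<le> N\<close> by auto
    from run_update[OF this(1)] run_step[OF this(2)] show ?thesis
      by simp
  qed
  then have fin: "finite (V (i - 1))"
    using finite_vert[OF P] finite_subset by blast
  have i: "i \<in> {1..N}" "i \<in> {1..<N}" "i + 1 \<in> {1..N}"
    using \<open>1 \<le> i\<close> \<open>i + 1 \<le> N\<close> by auto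
  have w_max: "is_arg_max h (\<lambda>u. u \<in> convex hull (V (i - 1))) (w i)"
    and lam: "\<forall>u\<in>V (i - 1). lam i u \<ge> 0" "(\<Sum>u\<in>V (i - 1). lam i u) = 1"
      "w i = (\<Sum>u\<in>V (i - 1). lam i u *\<^sub>R u)"
    and grad: "GDERIV h (w i) :> r"
    and v_max: "is_arg_max (\<lambda>u. u \<bullet> r) (\<lambda>u. u \<in> ?P) (v i)"
    using run_step[OF i(1)] unfolding r_def by - (elim conjE, assumption)+
  have w_max': "is_arg_max h (\<lambda>u. u \<in> convex hull (V i)) (w (i + 1))"
    using run_step[OF i(3), THEN conjunct1] by simp
  \<comment> \<open>Since \<open>i < N\<close>, the stopping test failed in iteration
    \<open>i\<close>, so the gap exceeds \<open>\<epsilon>\<close>.\<close>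
  have "\<not> v i \<bullet> x i - w i \<bullet> x i \<le> \<epsilon>" and AB: "A \<subseteq> B i" and Vi: "V i = B i \<union> {v i}"
    using run_update[OF i(2)] by (simp_all add: A_def)
  then have gap: "gap > 0"
    using \<open>\<epsilon> \<ge> 0\<close> by (simp add: gap_def r_def)
  obtain y where "GDERIV h (w i) :> y"
    and "\<forall>u. h u \<le> h (w i) + (u - w i) \<bullet> y - (norm (u - w i))\<^sup>2 / (2 * \<alpha>)"
    and "\<forall>u. h u \<ge> h (w i) + (u - w i) \<bullet> y - (norm (u - w i))\<^sup>2 / (2 * \<beta>)"
    using bounds by (rule dual_objective_gradient)
  then have up: "\<And>u. h u \<le> h (w i) + (u - w i) \<bullet> r - (norm (u - w i))\<^sup>2 / (2 * \<alpha>)"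
    and lo: "\<And>u. h u \<ge> h (w i) + (u - w i) \<bullet> r - (norm (u - w i))\<^sup>2 / (2 * \<beta>)"
    using GDERIV_unique[OF grad] by simp_all

  have A_sum: "sum (lam i) A = 1" "w i = (\<Sum>u\<in>A. lam i u *\<^sub>R u)"
  proof -
    have "sum (lam i) A = sum (lam i) (V (i - 1))"
      "(\<Sum>u\<in>A. lam i u *\<^sub>R u) = (\<Sum>u\<in>V (i - 1). lam i u *\<^sub>R u)"
      using fin lam(1) by (auto simp: A_def less_le intro!: sum.mono_neutral_left)
    then show "sum (lam i) A = 1" "w i = (\<Sum>u\<in>A. lam i u *\<^sub>R u)"
      using lam by simp_all
  qed
  have A: "A \<in> active_sets (vert ?P) (w i)"
    using A_sum V_vert by (auto simp: active_sets_def A_def intro!: exI[of _ "lam i"])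
  have "finite A"
    using fin by (simp add: A_def)
  have w_hull: "w i \<in> convex hull A"
    unfolding convex_hull_finite[OF \<open>finite A\<close>] using A_sum
    by (auto simp: A_def intro!: exI[of _ "lam i"])
  have wP: "w i \<in> ?P"
  proof -
    have "convex hull A \<subseteq> ?P"
      using V_vert vert_subset[of ?P] P by (intro hull_minimal polytope_imp_convex) (auto simp: A_def)
    then show ?thesis
      using w_hull by blast
  qed
  have vP: "v i \<in> ?P" and v_le: "\<And>u. u \<in> ?P \<Longrightarrow> r \<bullet> u \<le> r \<bullet> v i"
    using v_max by (auto simp: is_arg_max_def not_less inner_commute)

  \<comment> \<open>Since \<open>w i\<close> is optimal on the convex hull of \<open>V (i - 1)\<close>, every active vertex is an away vertex.\<close>
  have le: "r \<bullet> u \<le> r \<bullet> w i" if "u \<in> V (i - 1)" for u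
    using maximizer_imp_supporting[OF lo, of "convex hull (V (i - 1))" u] w_max that
    by (auto simp: is_arg_max_def not_less inner_commute hull_inc)
  then have level: "r \<bullet> a = r \<bullet> w i" if "a \<in> A" for a
    using convex_combination_maximal_level[OF \<open>finite A\<close> _ A_sum _ that] by (simp add: A_def)

  have "?P \<noteq> {}"
    using wP by blast
  with bounds obtain ws where ws: "ws \<in> ?P" and "(INF y. lovasz_extension F y + g y) \<le> h ws"
    by (rule strong_duality)
  then have p_star: "p_star \<le> h ws"
    using \<open>p_star = _\<close> by simp
  have "norm (v i - w i) \<le> M"
    using diameter_bounded_bound[OF polytope_imp_bounded[OF P] vP wP] \<open>M = _\<close> by (simp add: dist_norm)
  moreover have "v i \<noteq> w i"
    using gap by (auto simp: gap_def)
  ultimately have M: "M > 0"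
    by (smt (verit) zero_less_norm_iff right_minus_eq)
  \<comment> \<open>Both quadratic bounds at the single point \<open>v i\<close>, which differs from
    \<open>w i\<close>, already compare the constants.\<close>
  have "\<beta> \<le> \<alpha>"
  proof -
    have "(norm (v i - w i))\<^sup>2 / (2 * \<alpha>) \<le> (norm (v i - w i))\<^sup>2 / (2 * \<beta>)"
      using up[of "v i"] lo[of "v i"] by simp
    then show ?thesis
      using \<open>v i \<noteq> w i\<close> \<beta> bounds(1)
      by (simp add: smooth_def divide_le_cancel field_simps)
  qed
  \<comment> \<open>The width lemma is used with \<open>v i\<close> as target; the positive gap is
    the slope it requires.\<close>
  have width: "0 \<le> \<delta>" "\<delta> \<le> M"
    using PWidth_bound[OF P wP vP _ A level v_le] gap \<open>M = _\<close> \<open>\<delta> = _\<close>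
    by (auto simp: gap_def inner_diff_right inner_commute)
  have width': "\<delta> * (r \<bullet> (ws - w i)) \<le> gap * norm (ws - w i)"
  proof (cases "r \<bullet> (ws - w i) > 0")
    case True
    then show ?thesis
      using PWidth_bound(3)[OF P wP ws True A level v_le] \<open>\<delta> = _\<close>
      by (simp add: gap_def inner_diff_right inner_commute)
  next
    case False
    then have "\<delta> * (r \<bullet> (ws - w i)) \<le> 0"
      using width(1) by (simp add: mult_nonneg_nonpos)
    also have "0 \<le> gap * norm (ws - w i)"
      using gap by simp
    finally show ?thesis .
  qed
  have "\<beta> / (4 * \<alpha>) * (\<delta> / M)\<^sup>2 * (h ws - h (w i)) \<le> h (w (i + 1)) - h (w i)"
  proof (rule frank_wolfe_progress[OF \<beta> \<open>\<beta> \<le> \<alpha>\<close> width(1,2) M gap _ _ width'])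
    show "h ws - h (w i) \<le> r \<bullet> (ws - w i) - (norm (ws - w i))\<^sup>2 / (2 * \<alpha>)"
      using up[of ws] by (simp add: inner_commute)
    show "r \<bullet> (ws - w i) \<le> gap"
      using v_le[OF ws] by (simp add: gap_def inner_diff_right inner_commute)
    fix \<gamma> :: real assume \<gamma>: "0 \<le> \<gamma>" "\<gamma> \<le> 1"
    let ?u = "w i + \<gamma> *\<^sub>R (v i - w i)"
    \<comment> \<open>\<open>B i\<close> keeps every active vertex, so the segment from
      \<open>w i\<close> to \<open>v i\<close> lies in the hull over which \<open>w (i + 1)\<close>
      is optimal.\<close>
    have "w i \<in> convex hull (V i)" "v i \<in> convex hull (V i)"
      using w_hull hull_mono[of A "V i"] AB Vi by (auto intro: hull_inc)
    moreover have "?u = (1 - \<gamma>) *\<^sub>R w i + \<gamma> *\<^sub>R v i"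
      by (simp add: algebra_simps)
    ultimately have "?u \<in> convex hull (V i)"
      using \<gamma> by (simp add: convexD)
    then have "h ?u \<le> h (w (i + 1))"
      using w_max' by (auto simp: is_arg_max_def not_less)
    moreover have "h ?u \<ge> h (w i) + \<gamma> * gap - \<gamma>\<^sup>2 * (norm (v i - w i))\<^sup>2 / (2 * \<beta>)"
      using lo[of ?u] by (simp add: gap_def power_mult_distrib inner_diff_left)
    moreover have "\<gamma>\<^sup>2 * (norm (v i - w i))\<^sup>2 / (2 * \<beta>) \<le> \<gamma>\<^sup>2 * M\<^sup>2 / (2 * \<beta>)"
      using \<open>norm (v i - w i) \<le> M\<close> \<beta> by (intro divide_right_mono mult_left_mono power_mono) auto
    ultimately show "\<gamma> * gap - \<gamma>\<^sup>2 * M\<^sup>2 / (2 * \<beta>) \<le> h (w (i + 1)) - h (w i)"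
      by simp
  qed
  \<comment> \<open>As \<open>\<rho>\<close> is nonnegative, the dual value at \<open>ws\<close> may
    be lowered to \<open>p_star\<close>.\<close>
  moreover have "\<rho> * (p_star - h (w i)) \<le> \<rho> * (h ws - h (w i))"
    using p_star \<beta> \<open>\<beta> \<le> \<alpha>\<close> unfolding \<open>\<rho> = _\<close> by (intro mult_left_mono) auto
  ultimately have "\<rho> * (p_star - h (w i)) \<le> h (w (i + 1)) - h (w i)"
    using \<open>\<rho> = _\<close> by simp
  then show ?thesis
    using \<open>d = _\<close> by (simp add: lfcfw_lower_bound_def algebra_simps)
qed

end
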